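(* Let $c\ge 0$ be a constant. For all sufficiently large $n$, every $c\log n$-random labeled graph $G$ on $n$ nodes admits, in model IB and in model II, a shortest path routing scheme in which each local routing function is stored in at most $3n$ bits; hence the whole routing scheme uses at most $3n^2$ bits.
   Context: $C(x\mid y)$ is Kolmogorov complexity w.r.t. a fixed universal Turing machine; $\log$ is base 2. A labeled graph $G$ on $V=\{1,\dots,n\}$ is encoded by $E(G)\in\{0,1\}^{n(n-1)/2}$ (bit $i$ indicates the $i$-th possible edge in lexicographic order); with $\mathcal G$ the set of all labeled graphs on $V$, $G$ is $\delta(n)$-random if $C(E(G)\mid n,\delta,\mathcal G)\ge n(n-1)/2-\delta(n)$. Routing: the edges at a node $v$ of degree $\deg(v)$ are attached to ports labeled $1,\dots,\deg(v)$ (a port assignment). A routing scheme consists of a local routing function at every node $u$ which, for every destination label $v\neq u$, returns an edge (port) at $u$; following these choices yields a route from $u$ to $v$. It is a shortest path routing scheme if all routes are shortest paths; its stretch factor is the maximum over pairs of the ratio of route length to distance. The space of a scheme is the total number of bits used to store all local routing functions (plus, in model $\gamma$, the bits of node labels). Models: IA: nodes do not know their neighbours' labels, only distinguish ports, and the port assignment is fixed (chosen adversarially); IB: as IA but the port assignment may be freely chosen before computing the scheme; II: each node knows for free the labels of its neighbours and over which edge each is reached. $\alpha$: no relabeling of nodes; $\beta$: nodes may be relabeled by a permutation of $\{1,\dots,n\}$; $\gamma$: nodes may be given arbitrary labels, destinations are specified by the new labels, and the bits of each node's label are charged to its space. *)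

theory Defs
  imports Complex_Main
begin

datatype recf = Zf | Sf | Proj nat | Comp recf "recf list" | Prim recf recf | Mn recf

inductive eval :: "recf \<Rightarrow> nat list \<Rightarrow> nat \<Rightarrow> bool" where
  ev_Z: "eval Zf xs 0"
| ev_S: "eval Sf (x # xs) (Suc x)"
| ev_Proj: "i < length xs \<Longrightarrow> eval (Proj i) xs (xs ! i)"
| ev_Comp: "length ys = length gs \<Longrightarrow> (\<forall>i < length gs. eval (gs ! i) xs (ys ! i))
             \<Longrightarrow> eval f ys z \<Longrightarrow> eval (Comp f gs) xs z"
| ev_Prim0: "eval f xs z \<Longrightarrow> eval (Prim f g) (0 # xs) z"
| ev_PrimS: "eval (Prim f g) (m # xs) r \<Longrightarrow> eval g (r # m # xs) z
             \<Longrightarrow> eval (Prim f g) (Suc m # xs) z"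
| ev_Mn: "eval f (z # xs) 0 \<Longrightarrow> (\<forall>y < z. \<exists>r. eval f (y # xs) r \<and> r \<noteq> 0)
             \<Longrightarrow> eval (Mn f) xs z"

text \<open>Bijective coding of binary strings by natural numbers.\<close>
fun nat_of_bits :: "bool list \<Rightarrow> nat" where
  "nat_of_bits [] = 0"
| "nat_of_bits (b # bs) = 2 * nat_of_bits bs + (if b then 2 else 1)"

function bits_of_nat :: "nat \<Rightarrow> bool list" where
  "bits_of_nat n = (if n = 0 then [] else even n # bits_of_nat ((n - 1) div 2))"
  by auto
termination by (relation "measure id") auto

text \<open>A (conditional) description method: program, condition \<mapsto> output (partial).\<close>
type_synonym descr = "bool list \<Rightarrow> bool list \<Rightarrow> bool list option"

definition partial_computable :: "descr \<Rightarrow> bool" where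
  "partial_computable \<phi> \<longleftrightarrow> (\<exists>f. \<forall>p y x.
      \<phi> p y = Some x \<longleftrightarrow> eval f [nat_of_bits p, nat_of_bits y] (nat_of_bits x))"

definition universal :: "descr \<Rightarrow> bool" where
  "universal U \<longleftrightarrow> partial_computable U \<and>
     (\<forall>\<phi>. partial_computable \<phi> \<longrightarrow> (\<exists>c. \<forall>p y x. \<phi> p y = Some x \<longrightarrow>
        (\<exists>q. U q y = Some x \<and> length q \<le> length p + c)))"

definition KC :: "descr \<Rightarrow> bool list \<Rightarrow> bool list \<Rightarrow> nat" where
  "KC U x y = (LEAST k. \<exists>p. length p = k \<and> U p y = Some x)"

definition labeled_graph :: "nat \<Rightarrow> (nat \<Rightarrow> nat \<Rightarrow> bool) \<Rightarrow> bool" where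
  "labeled_graph n G \<longleftrightarrow> (\<forall>u v. G u v \<longrightarrow> u \<in> {1..n} \<and> v \<in> {1..n} \<and> u \<noteq> v \<and> G v u)"

definition edge_list :: "nat \<Rightarrow> (nat \<times> nat) list" where
  "edge_list n = concat (map (\<lambda>i. map (\<lambda>j. (i, j)) [i+1..<n+1]) [1..<n+1])"

definition graph_code :: "nat \<Rightarrow> (nat \<Rightarrow> nat \<Rightarrow> bool) \<Rightarrow> bool list" where
  "graph_code n G = map (\<lambda>(i, j). G i j) (edge_list n)"

definition random_graph :: "descr \<Rightarrow> real \<Rightarrow> nat \<Rightarrow> (nat \<Rightarrow> nat \<Rightarrow> bool) \<Rightarrow> bool" where
  "random_graph U \<delta> n G \<longleftrightarrow> labeled_graph n G \<and>
     real (KC U (graph_code n G) (bits_of_nat n)) \<ge> real (n * (n - 1) div 2) - \<delta>"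

definition deg :: "(nat \<Rightarrow> nat \<Rightarrow> bool) \<Rightarrow> nat \<Rightarrow> nat" where
  "deg G x = card {w. G x w}"

definition walk_of_len :: "(nat \<Rightarrow> nat \<Rightarrow> bool) \<Rightarrow> nat \<Rightarrow> nat \<Rightarrow> nat \<Rightarrow> bool" where
  "walk_of_len G u v k \<longleftrightarrow> (\<exists>xs. length xs = Suc k \<and> xs ! 0 = u \<and> xs ! k = v \<and>
       (\<forall>i < k. G (xs ! i) (xs ! Suc i)))"

definition gdist :: "(nat \<Rightarrow> nat \<Rightarrow> bool) \<Rightarrow> nat \<Rightarrow> nat \<Rightarrow> nat" where
  "gdist G u v = (LEAST k. walk_of_len G u v k)"

text \<open>nxt v x = the node to which x forwards a message destined for v.
  All routes are shortest paths: from every u \<noteq> v the route reaches v along edges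
  after exactly dist(u,v) steps (and v is reachable from u).\<close>
definition shortest_path_routing ::
  "nat \<Rightarrow> (nat \<Rightarrow> nat \<Rightarrow> bool) \<Rightarrow> (nat \<Rightarrow> nat \<Rightarrow> nat) \<Rightarrow> bool" where
  "shortest_path_routing n G nxt \<longleftrightarrow> (\<forall>u \<in> {1..n}. \<forall>v \<in> {1..n}. u \<noteq> v \<longrightarrow>
     (\<exists>k. walk_of_len G u v k) \<and>
     ((nxt v ^^ gdist G u v) u = v) \<and>
     (\<forall>i < gdist G u v. G ((nxt v ^^ i) u) ((nxt v ^^ Suc i) u)))"

definition port_assignment :: "nat \<Rightarrow> (nat \<Rightarrow> nat \<Rightarrow> bool) \<Rightarrow> (nat \<Rightarrow> nat \<Rightarrow> nat) \<Rightarrow> bool" where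
  "port_assignment n G P \<longleftrightarrow> (\<forall>x \<in> {1..n}. bij_betw (P x) {w. G x w} {1..deg G x})"

text \<open>Model IB. A decoder D (fixed, independent of the graph) computes the local routing
  function at node x from: n, the node's own label x, its number of ports deg x,
  the bit string stored at x, and the destination label v; it returns a port.
  The port assignment P may be chosen together with the scheme.\<close>
definition IB_scheme ::
  "(nat \<Rightarrow> nat \<Rightarrow> nat \<Rightarrow> bool list \<Rightarrow> nat \<Rightarrow> nat) \<Rightarrow> nat \<Rightarrow> (nat \<Rightarrow> nat \<Rightarrow> bool)
   \<Rightarrow> (nat \<Rightarrow> nat \<Rightarrow> nat) \<Rightarrow> (nat \<Rightarrow> bool list) \<Rightarrow> bool" where
  "IB_scheme D n G P mem \<longleftrightarrow> port_assignment n G P \<and>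
     (\<forall>x \<in> {1..n}. \<forall>v \<in> {1..n}. x \<noteq> v \<longrightarrow> D n x (deg G x) (mem x) v \<in> {1..deg G x}) \<and>
     shortest_path_routing n G
       (\<lambda>v x. inv_into {w. G x w} (P x) (D n x (deg G x) (mem x) v))"

text \<open>Model II. Node x knows for free the labels of its neighbours (and over which edge each
  is reached); the decoder returns the neighbour to forward to.\<close>
definition II_scheme ::
  "(nat \<Rightarrow> nat \<Rightarrow> nat set \<Rightarrow> bool list \<Rightarrow> nat \<Rightarrow> nat) \<Rightarrow> nat \<Rightarrow> (nat \<Rightarrow> nat \<Rightarrow> bool)
   \<Rightarrow> (nat \<Rightarrow> bool list) \<Rightarrow> bool" where
  "II_scheme D n G mem \<longleftrightarrow>
     shortest_path_routing n G (\<lambda>v x. D n x {w. G x w} (mem x) v)"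

end

theory Submission
  imports Defs "HOL-Real_Asymp.Real_Asymp"
begin

text \<open>
  Node \<^term>\<open>u\<close> stores, for every destination \<^term>\<open>v\<close>, a number in unary: 0 if \<^term>\<open>v\<close> is a neighbour, and
  otherwise the position (in the list of neighbours of \<^term>\<open>u\<close>) of the first common neighbour of \<^term>\<open>u\<close>
  and \<^term>\<open>v\<close>. In a uniformly random graph the length of the code for \<^term>\<open>v\<close> is the number of fair coin
  flips up to the first success, one flip for the edge $uv$ and one for each candidate for a
  common neighbour, and these lengths are essentially independent for different \<^term>\<open>v\<close>. So a
  table has about $2n$ bits, and by an exponential moment bound it exceeds $3n$ bits only with
  probability at most $(27/32)^n$. A pair of nodes has no common neighbour with probability at
  most $(3/4)^{n-2}$. Being bad in one of these ways is decidable, so a bad graph is described by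
  its index among all bad graphs on \<^term>\<open>n\<close> nodes, which saves a linear number of bits and contradicts
  randomness for large \<^term>\<open>n\<close>.
\<close>

subsection \<open>Computable functions and decidable predicates\<close>

text \<open>In the \<open>Mn\<close> case, the smaller of two distinct results would have value 0 as
  a result and a nonzero value as a predecessor of the larger one. Determinism later allows the
  output of a program to be named by \<open>THE\<close>.\<close>

lemma eval_deterministic: "eval f xs z \<Longrightarrow> eval f xs z' \<Longrightarrow> z = z'"
proof (induction arbitrary: z' rule: eval.induct)
  case (ev_Z xs) then show ?case by (auto elim: eval.cases)
next
  case (ev_S x xs) then show ?case by (auto elim: eval.cases)
next
  case (ev_Proj i xs) from ev_Proj(2) show ?case by (auto elim: eval.cases)
next
  case (ev_Comp ys gs xs f z)
  from ev_Comp.prems show ?case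
  proof cases
    case (ev_Comp ys')
    have "ys = ys'"
      using ev_Comp ev_Comp.hyps ev_Comp.IH by (intro nth_equalityI) auto
    then show ?thesis using ev_Comp ev_Comp.IH by blast
  qed
next
  case (ev_Prim0 f xs z g) from ev_Prim0.prems ev_Prim0.IH show ?case by (auto elim: eval.cases)
next
  case (ev_PrimS f g m xs r z)
  from ev_PrimS.prems show ?case
    by cases (use ev_PrimS.IH in blast)
next
  case (ev_Mn f z xs)
  from ev_Mn.prems show ?case
  proof cases
    case ev_Mn
    then show ?thesis using ev_Mn.IH by (metis linorder_neqE_nat)
  qed
qed

text \<open>The argument list acts as an environment: every bound variable of a sum or quantifier
  becomes a new head. Closure rules can then follow the shape of a term.\<close>

definition computable :: "nat \<Rightarrow> (nat list \<Rightarrow> nat) \<Rightarrow> bool" where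
  "computable k F \<longleftrightarrow> (\<exists>f. \<forall>xs. length xs = k \<longrightarrow> eval f xs (F xs))"

definition decidable :: "nat \<Rightarrow> (nat list \<Rightarrow> bool) \<Rightarrow> bool" where
  "decidable k P \<longleftrightarrow> computable k (\<lambda>xs. of_bool (P xs))"

lemma computable_cong:
  assumes "computable k F" "\<And>xs. length xs = k \<Longrightarrow> F xs = G xs"
  shows "computable k G"
  using assms unfolding computable_def by metis

section \<open>Closure under composition and primitive recursion\<close>

lemma computable_nth: "i < k \<Longrightarrow> computable k (\<lambda>xs. xs ! i)"
  unfolding computable_def by (metis ev_Proj)

lemma computable_compose:
  assumes "computable m F" "\<And>i. i < m \<Longrightarrow> computable k (G i)"
  shows "computable k (\<lambda>xs. F (map (\<lambda>i. G i xs) [0..<m]))"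
proof -
  obtain f where f: "\<And>xs. length xs = m \<Longrightarrow> eval f xs (F xs)"
    using assms(1) unfolding computable_def by blast
  obtain g where g: "\<And>i xs. i < m \<Longrightarrow> length xs = k \<Longrightarrow> eval (g i) xs (G i xs)"
    using assms(2) unfolding computable_def by metis
  have "eval (Comp f (map g [0..<m])) xs (F (map (\<lambda>i. G i xs) [0..<m]))" if "length xs = k" for xs
    by (rule ev_Comp[where ys = "map (\<lambda>i. G i xs) [0..<m]"]) (use f g that in auto)
  then show ?thesis unfolding computable_def by blast
qed

lemma computable_compose_Cons:
  assumes "computable (Suc k) F" "computable k B"
  shows "computable k (\<lambda>xs. F (B xs # xs))"
proof -
  have "computable k (\<lambda>xs. F (map (\<lambda>i. (case i of 0 \<Rightarrow> B xs | Suc j \<Rightarrow> xs ! j)) [0..<Suc k]))"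
    by (intro computable_compose) (auto simp: assms less_Suc_eq_0_disj intro: computable_nth)
  then show ?thesis
  proof (rule computable_cong)
    fix xs :: "nat list" assume "length xs = k"
    then have "map (case_nat (B xs) ((!) xs)) [0..<Suc k] = B xs # xs"
      by (intro nth_equalityI) (auto simp del: upt_Suc simp: nth_Cons split: nat.split)
    then show "F (map (case_nat (B xs) ((!) xs)) [0..<Suc k]) = F (B xs # xs)" by simp
  qed
qed

lemma computable_Suc:
  assumes "computable k A" shows "computable k (\<lambda>xs. Suc (A xs))"
proof -
  have "computable (Suc k) (\<lambda>ys. Suc (hd ys))"
    unfolding computable_def by (intro exI[of _ Sf]) (auto simp: length_Suc_conv intro: ev_S)
  from computable_compose_Cons[OF this assms] show ?thesis by simp
qed

lemma computable_const: "computable k (\<lambda>xs. c)"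
proof (induction c)
  case 0 show ?case unfolding computable_def by (intro exI[of _ Zf]) (auto intro: ev_Z)
next
  case (Suc c) then show ?case by (rule computable_Suc)
qed

lemma computable_hd: "0 < k \<Longrightarrow> computable k (\<lambda>xs. hd xs)"
  by (rule computable_cong[OF computable_nth[of 0]]) (auto simp: hd_conv_nth)

text \<open>Weakening: a term that does not mention the newest bound variable sees the environment
  without its head.\<close>

lemma computable_tl:
  assumes "computable k F" shows "computable (Suc k) (\<lambda>xs. F (tl xs))"
proof -
  have "computable (Suc k) (\<lambda>xs. F (map (\<lambda>i. xs ! Suc i) [0..<k]))"
    using assms by (intro computable_compose) (auto intro: computable_nth)
  then show ?thesis
  proof (rule computable_cong)
    fix xs :: "nat list" assume "length xs = Suc k"
    then have "map (\<lambda>i. xs ! Suc i) [0..<k] = tl xs"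
      by (intro nth_equalityI) (auto simp: nth_tl)
    then show "F (map (\<lambda>i. xs ! Suc i) [0..<k]) = F (tl xs)" by simp
  qed
qed

text \<open>\<open>Prim\<close> passes the recursive value before the counter, hence
  \<open>hd ys\<close> for the value and \<open>hd (tl ys)\<close> for the counter. The bound is
  first an extra head argument, for which \<open>B\<close> is then substituted.\<close>

lemma computable_rec_nat:
  assumes A: "computable k A" and B: "computable k B"
    and H: "computable (Suc (Suc k)) (\<lambda>ys. H (hd (tl ys)) (hd ys) (tl (tl ys)))"
  shows "computable k (\<lambda>xs. rec_nat (A xs) (\<lambda>m r. H m r xs) (B xs))"
proof -
  obtain f where f: "\<And>xs. length xs = k \<Longrightarrow> eval f xs (A xs)"
    using A unfolding computable_def by blast
  obtain h where h: "\<And>ys. length ys = Suc (Suc k) \<Longrightarrow> eval h ys (H (hd (tl ys)) (hd ys) (tl (tl ys)))"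
    using H unfolding computable_def by blast
  have ev: "eval (Prim f h) (b # xs) (rec_nat (A xs) (\<lambda>m r. H m r xs) b)" if "length xs = k" for b xs
  proof (induction b)
    case 0 show ?case using f that by (auto intro: ev_Prim0)
  next
    case (Suc b)
    have "eval h (rec_nat (A xs) (\<lambda>m r. H m r xs) b # b # xs) (H b (rec_nat (A xs) (\<lambda>m r. H m r xs) b) xs)"
      using h[of "rec_nat (A xs) (\<lambda>m r. H m r xs) b # b # xs"] that by simp
    with Suc show ?case by (auto intro: ev_PrimS)
  qed
  have "computable (Suc k) (\<lambda>ys. rec_nat (A (tl ys)) (\<lambda>m r. H m r (tl ys)) (hd ys))"
    unfolding computable_def by (intro exI[of _ "Prim f h"]) (auto simp: length_Suc_conv ev)
  from computable_compose_Cons[OF this B] show ?thesis by simp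
qed

lemma computable_pred: "computable k A \<Longrightarrow> computable k (\<lambda>xs. A xs - 1)"
proof (rule computable_cong)
  assume "computable k A"
  then show "computable k (\<lambda>xs. rec_nat 0 (\<lambda>m r. m) (A xs))"
    by (intro computable_rec_nat computable_tl computable_hd computable_const) auto
next
  fix xs show "rec_nat 0 (\<lambda>m r. m) (A xs) = A xs - 1" by (cases "A xs") auto
qed

lemma computable_add:
  assumes "computable k A" "computable k B" shows "computable k (\<lambda>xs. A xs + B xs)"
proof (rule computable_cong)
  show "computable k (\<lambda>xs. rec_nat (A xs) (\<lambda>m r. Suc r) (B xs))"
    using assms by (intro computable_rec_nat computable_Suc computable_hd) auto
next
  fix xs
  have "rec_nat a (\<lambda>m r. Suc r) b = a + b" for a b :: nat by (induction b) auto
  then show "rec_nat (A xs) (\<lambda>m r. Suc r) (B xs) = A xs + B xs" .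
qed

lemma computable_diff:
  assumes "computable k A" "computable k B" shows "computable k (\<lambda>xs. A xs - B xs)"
proof (rule computable_cong)
  show "computable k (\<lambda>xs. rec_nat (A xs) (\<lambda>m r. r - 1) (B xs))"
    using assms by (intro computable_rec_nat computable_pred computable_hd) auto
next
  fix xs
  have "rec_nat a (\<lambda>m r. r - 1) b = a - b" for a b :: nat by (induction b) auto
  then show "rec_nat (A xs) (\<lambda>m r. r - 1) (B xs) = A xs - B xs" .
qed

lemma computable_sum:
  assumes "computable k B" "computable (Suc k) (\<lambda>ys. F (hd ys) (tl ys))"
  shows "computable k (\<lambda>xs. \<Sum>i<B xs. F i xs)"
proof (rule computable_cong)
  have "computable (Suc (Suc k)) (\<lambda>ys. F (hd (tl ys)) (tl (tl ys)))"
    using computable_tl[OF assms(2)] .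
  then show "computable k (\<lambda>xs. rec_nat 0 (\<lambda>m r. r + F m xs) (B xs))"
    using assms by (intro computable_rec_nat computable_add computable_hd computable_const) auto
next
  fix xs
  have "rec_nat 0 (\<lambda>m r. r + F m xs) b = (\<Sum>i<b. F i xs)" for b by (induction b) auto
  then show "rec_nat 0 (\<lambda>m r. r + F m xs) (B xs) = (\<Sum>i<B xs. F i xs)" .
qed

lemma computable_mult:
  assumes "computable k A" "computable k B" shows "computable k (\<lambda>xs. A xs * B xs)"
proof (rule computable_cong)
  show "computable k (\<lambda>xs. \<Sum>i<B xs. A xs)"
    using assms by (intro computable_sum computable_tl)
qed simp

lemma computable_power:
  assumes "computable k A" "computable k B" shows "computable k (\<lambda>xs. A xs ^ B xs)"
proof (rule computable_cong)
  show "computable k (\<lambda>xs. rec_nat 1 (\<lambda>m r. r * A xs) (B xs))"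
    using assms
    by (intro computable_rec_nat computable_mult computable_tl computable_hd computable_const) auto
next
  fix xs
  have "rec_nat 1 (\<lambda>m r. r * a) b = a ^ b" for a b :: nat by (induction b) auto
  then show "rec_nat 1 (\<lambda>m r. r * A xs) (B xs) = A xs ^ B xs" .
qed

section \<open>Decidable predicates, bounded quantifiers and division\<close>

lemma computable_of_bool: "decidable k P \<Longrightarrow> computable k (\<lambda>xs. of_bool (P xs))"
  unfolding decidable_def .

lemma decidable_cong:
  assumes "decidable k P" "\<And>xs. length xs = k \<Longrightarrow> P xs = Q xs"
  shows "decidable k Q"
  using assms computable_cong[of k "\<lambda>xs. of_bool (P xs)" "\<lambda>xs. of_bool (Q xs)"]
  unfolding decidable_def by simp

lemma decidable_le:
  assumes "computable k A" "computable k B" shows "decidable k (\<lambda>xs. A xs \<le> B xs)"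
  unfolding decidable_def
proof (rule computable_cong)
  show "computable k (\<lambda>xs. 1 - (A xs - B xs))"
    using assms by (intro computable_diff computable_const)
qed auto

lemma decidable_not: "decidable k P \<Longrightarrow> decidable k (\<lambda>xs. \<not> P xs)"
  unfolding decidable_def
proof (rule computable_cong)
  assume "computable k (\<lambda>xs. of_bool (P xs))"
  then show "computable k (\<lambda>xs. 1 - of_bool (P xs))" by (intro computable_diff computable_const)
qed auto

lemma decidable_conj: "decidable k P \<Longrightarrow> decidable k Q \<Longrightarrow> decidable k (\<lambda>xs. P xs \<and> Q xs)"
  unfolding decidable_def of_bool_conj by (rule computable_mult)

lemma decidable_disj:
  assumes "decidable k P" "decidable k Q" shows "decidable k (\<lambda>xs. P xs \<or> Q xs)"
proof (rule decidable_cong)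
  show "decidable k (\<lambda>xs. \<not> (\<not> P xs \<and> \<not> Q xs))"
    using assms by (intro decidable_not decidable_conj)
qed auto

lemma decidable_less:
  assumes "computable k A" "computable k B" shows "decidable k (\<lambda>xs. A xs < B xs)"
  unfolding not_le[symmetric] using assms by (intro decidable_not decidable_le)

lemma decidable_eq:
  fixes A :: "nat list \<Rightarrow> nat"
  assumes "computable k A" "computable k B" shows "decidable k (\<lambda>xs. A xs = B xs)"
  unfolding eq_iff using assms by (intro decidable_conj decidable_le)

lemma decidable_Bex:
  assumes "computable k B" "decidable (Suc k) (\<lambda>ys. P (hd ys) (tl ys))"
  shows "decidable k (\<lambda>xs. \<exists>i<B xs. P i xs)"
proof (rule decidable_cong)
  show "decidable k (\<lambda>xs. 0 < (\<Sum>i<B xs. of_bool (P i xs) :: nat))"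
    using assms by (intro decidable_less computable_sum computable_const computable_of_bool)
qed (auto simp: sum_nonneg_eq_0_iff simp flip: neq0_conv)

lemma decidable_Ball:
  assumes "computable k B" "decidable (Suc k) (\<lambda>ys. P (hd ys) (tl ys))"
  shows "decidable k (\<lambda>xs. \<forall>i<B xs. P i xs)"
proof (rule decidable_cong)
  show "decidable k (\<lambda>xs. \<not> (\<exists>i<B xs. \<not> P i xs))"
    using assms by (intro decidable_not decidable_Bex)
qed auto

lemma computable_if:
  assumes "decidable k P" "computable k A" "computable k B"
  shows "computable k (\<lambda>xs. if P xs then A xs else B xs)"
proof (rule computable_cong)
  show "computable k (\<lambda>xs. of_bool (P xs) * A xs + of_bool (\<not> P xs) * B xs)"
    using assms by (intro computable_add computable_mult computable_of_bool decidable_not)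
qed auto

lemma computable_div:
  assumes "computable k A" "computable k B" shows "computable k (\<lambda>xs. A xs div B xs)"
proof (rule computable_cong)
  \<comment> \<open>The quotient is the number of positive multiples of the divisor up to the
    dividend. A zero divisor is separated because there all \<open>A xs\<close> terms would count,
    while \<open>div\<close> returns 0.\<close>
  show "computable k (\<lambda>xs. if B xs = 0 then 0 else \<Sum>q<A xs. of_bool (Suc q * B xs \<le> A xs))"
    using assms
    by (intro computable_if computable_sum computable_of_bool decidable_le decidable_eq
        computable_mult computable_tl computable_hd computable_const computable_Suc) auto
next
  fix xs
  have "(\<Sum>q<a. of_bool (Suc q * b \<le> a)) = a div b" if "b > 0" for a b :: nat
  proof -
    have "{..<a} \<inter> {q. Suc q * b \<le> a} = {..<a div b}"
      using that order_trans[OF _ div_le_dividend[of a b]]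
      by (auto simp: less_eq_div_iff_mult_less_eq simp del: mult_Suc simp flip: Suc_le_eq)
    then show ?thesis by (simp add: sum_of_bool_eq)
  qed
  then show "(if B xs = 0 then 0 else \<Sum>q<A xs. of_bool (Suc q * B xs \<le> A xs)) = A xs div B xs"
    by simp
qed

lemma decidable_odd:
  assumes "computable k A" shows "decidable k (\<lambda>xs. odd (A xs))"
proof (rule decidable_cong)
  show "decidable k (\<lambda>xs. A xs - 2 * (A xs div 2) = 1)"
    using assms by (intro decidable_eq computable_diff computable_mult computable_div computable_const)
qed presburger

lemmas computable_intros =
  computable_sum computable_add computable_diff computable_mult computable_power computable_div
  computable_if computable_of_bool computable_Suc computable_const decidable_le decidable_less
  decidable_eq decidable_not decidable_conj decidable_disj decidable_Bex decidable_Ball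
  decidable_odd

subsection \<open>Complexity of the members of a decidable set\<close>

declare bits_of_nat.simps [simp del]

lemma nat_of_bits_of_nat: "nat_of_bits (bits_of_nat n) = n"
proof (induction n rule: bits_of_nat.induct)
  case (1 n)
  show ?case
  proof (cases "n = 0")
    case True then show ?thesis by (simp add: bits_of_nat.simps[of 0])
  next
    case False
    then have "nat_of_bits (bits_of_nat n) = 2 * ((n - 1) div 2) + (if even n then 2 else 1)"
      using 1 by (simp add: bits_of_nat.simps[of n])
    also have "\<dots> = n" using False by presburger
    finally show ?thesis .
  qed
qed

lemma bits_of_nat_of_bits: "bits_of_nat (nat_of_bits bs) = bs"
  by (induction bs) (auto simp: bits_of_nat.simps[of 0] bits_of_nat.simps[of "Suc _"])

text \<open>\<open>Suc (nat_of_bits bs)\<close> is the binary numeral with digits \<open>bs\<close>,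
  least significant first, topped by a leading 1. Its size therefore determines the length of the
  string.\<close>

lemma nat_of_bits_bounds:
  "2 ^ length bs \<le> Suc (nat_of_bits bs)" "Suc (nat_of_bits bs) < 2 ^ Suc (length bs)"
  by (induction bs) auto

lemma odd_Suc_nat_of_bits_div:
  "k < length bs \<Longrightarrow> odd (Suc (nat_of_bits bs) div 2 ^ k) \<longleftrightarrow> bs ! k"
proof (induction bs arbitrary: k)
  case (Cons b bs)
  have "Suc (nat_of_bits (b # bs)) = 2 * Suc (nat_of_bits bs) + of_bool b" by simp
  then have "Suc (nat_of_bits (b # bs)) div 2 = Suc (nat_of_bits bs)"
    "odd (Suc (nat_of_bits (b # bs))) \<longleftrightarrow> b" by auto
  then show ?case using Cons
    by (cases k) (simp_all add: div_mult2_eq del: nat_of_bits.simps)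
qed simp

text \<open>An element \<^term>\<open>x\<close> is described by its index in the increasing enumeration of \<^term>\<open>{y. B n y}\<close>.\<close>
lemma two_power_KC_le:
  assumes U: "universal U" 
    and B: "\<And>k N X. computable k N \<Longrightarrow> computable k X \<Longrightarrow> decidable k (\<lambda>xs. B (N xs) (X xs))"
  shows "\<exists>C. \<forall>n x. B n x \<longrightarrow> finite {y. B n y} \<longrightarrow>
           2 ^ KC U (bits_of_nat x) (bits_of_nat n) \<le> 2 ^ C * card {y. B n y}"
proof -
  \<comment> \<open>With \<open>xs = [x, p, n]\<close>, the value is 0 iff more than
    \<open>p\<close> numbers up to \<open>x\<close> satisfy \<open>B n\<close>. The least such
    \<open>x\<close> is the member with exactly \<open>p\<close> smaller members, so minimization
    decodes an index.\<close>
  have "computable 3 (\<lambda>xs. Suc (xs ! 1) - (\<Sum>y<Suc (xs ! 0). of_bool (B (xs ! 2) y)))"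
    by (intro computable_intros B computable_tl computable_nth computable_hd) auto
  then obtain g where "\<And>xs. length xs = 3 \<Longrightarrow>
      eval g xs (Suc (xs ! 1) - (\<Sum>y<Suc (xs ! 0). of_bool (B (xs ! 2) y)))"
    unfolding computable_def by blast
  from this[of "[_, _, _]"]
  have g: "eval g [x, p, n] (Suc p - (\<Sum>y<Suc x. of_bool (B n y)))" for x p n by simp
  define f where "f = Mn g"
  \<comment> \<open>\<open>\<phi>\<close> is the partial function of \<open>f\<close> carried over
    to bit strings. The constant \<open>C\<close> below is the cost of simulating it on
    \<open>U\<close>, the same for all \<open>n\<close> and \<open>x\<close>.\<close>
  define \<phi> :: descr where "\<phi> p y = (if \<exists>z. eval f [nat_of_bits p, nat_of_bits y] z
      then Some (bits_of_nat (THE z. eval f [nat_of_bits p, nat_of_bits y] z)) else None)" for p y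
  have \<phi>: "\<phi> p y = Some x \<longleftrightarrow> eval f [nat_of_bits p, nat_of_bits y] (nat_of_bits x)" for p y x
  proof -
    have "(THE z. eval f [nat_of_bits p, nat_of_bits y] z) = z"
      if "eval f [nat_of_bits p, nat_of_bits y] z" for z
      using that eval_deterministic by blast
    then show ?thesis
      unfolding \<phi>_def by (metis bits_of_nat_of_bits nat_of_bits_of_nat option.inject option.simps(3))
  qed
  then obtain C where C: "\<And>p y x. \<phi> p y = Some x \<Longrightarrow> \<exists>q. U q y = Some x \<and> length q \<le> length p + C"
    using U unfolding universal_def partial_computable_def by metis
  have "2 ^ KC U (bits_of_nat x) (bits_of_nat n) \<le> 2 ^ C * card {y. B n y}"
    if x: "B n x" and fin: "finite {y. B n y}" for n x
  proof -
    define p where "p = card {y. y < x \<and> B n y}"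
    have count: "(\<Sum>y<m. of_bool (B n y)) = card {y. y < m \<and> B n y}" for m
      by (simp add: Int_def conj_commute)
    have "{y. y < Suc x \<and> B n y} = insert x {y. y < x \<and> B n y}"
      using x by (auto simp: less_Suc_eq)
    then have "eval g [x, p, n] 0"
      using g[of x p n] unfolding count p_def by simp
    moreover have "Suc p - (\<Sum>y<Suc z. of_bool (B n y)) \<noteq> 0" if "z < x" for z
    proof -
      have "card {y. y < Suc z \<and> B n y} \<le> p"
        unfolding p_def by (rule card_mono) (use that in auto)
      then show ?thesis unfolding count by simp
    qed
    ultimately have "eval f [p, n] x"
      unfolding f_def using g by (intro ev_Mn) blast+
    then have "\<phi> (bits_of_nat p) (bits_of_nat n) = Some (bits_of_nat x)"
      by (simp add: \<phi> nat_of_bits_of_nat)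
    then obtain q where q: "U q (bits_of_nat n) = Some (bits_of_nat x)"
      "length q \<le> length (bits_of_nat p) + C"
      using C by blast
    have "KC U (bits_of_nat x) (bits_of_nat n) \<le> length q"
      unfolding KC_def by (rule Least_le) (use q in blast)
    with q have "(2::nat) ^ KC U (bits_of_nat x) (bits_of_nat n) \<le> 2 ^ (C + length (bits_of_nat p))"
      by (intro power_increasing) auto
    also have "\<dots> \<le> 2 ^ C * Suc p"
      using nat_of_bits_bounds(1)[of "bits_of_nat p"] by (simp add: power_add nat_of_bits_of_nat del: mult_Suc_right)
    \<comment> \<open>\<open>p\<close> counts only members below \<open>x\<close>; the member
      \<open>x\<close> itself makes up for the \<open>Suc\<close>.\<close>
    also have "Suc p \<le> card {y. B n y}"
      unfolding p_def Suc_le_eq by (rule psubset_card_mono) (use x fin in auto)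
    finally show ?thesis by simp
  qed
  then show ?thesis by blast
qed

subsection \<open>Graphs without short routing tables\<close>

lemma nth_concat_map_upt:
  assumes "1 \<le> i" "i \<le> m" "k < length (f i)"
  shows "(\<Sum>a<i - 1. length (f (Suc a))) + k < length (concat (map f [1..<m + 1])) \<and>
         concat (map f [1..<m + 1]) ! ((\<Sum>a<i - 1. length (f (Suc a))) + k) = f i ! k"
  using assms
proof (induction m)
  case (Suc m)
  have len: "length (concat (map f [1..<m + 1])) = (\<Sum>a<m. length (f (Suc a)))"
    by (induction m) auto
  show ?case
  proof (cases "i = Suc m")
    case True
    then show ?thesis using Suc.prems len by (simp add: nth_append)
  next
    case False
    then show ?thesis using Suc by (auto simp: nth_append)
  qed
qed simp

text \<open>Rows 1 to \<open>i - 1\<close> of the edge list come first, row \<open>Suc a\<close>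
  having \<open>n - Suc a\<close> edges. An arithmetic formula is covered by the closure rules for
  computable functions.\<close>

definition edge_index :: "nat \<Rightarrow> nat \<Rightarrow> nat \<Rightarrow> nat" where
  "edge_index n i j = (\<Sum>a<i - 1. n - Suc a) + (j - Suc i)"

lemma nth_edge_list:
  assumes "1 \<le> i" "i < j" "j \<le> n"
  shows "edge_index n i j < length (edge_list n)" "edge_list n ! edge_index n i j = (i, j)"
  using nth_concat_map_upt[of i n "j - Suc i" "\<lambda>i. map (Pair i) [i + 1..<n + 1]"] assms
  by (simp_all add: edge_list_def edge_index_def del: upt_Suc)

lemma set_edge_list: "set (edge_list n) = {(i, j). 1 \<le> i \<and> i < j \<and> j \<le> n}"
  by (force simp: edge_list_def simp del: upt_Suc)

lemma length_edge_list: "length (edge_list n) = n * (n - 1) div 2"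
proof -
  have "length (edge_list n) = (\<Sum>i\<in>{1..n}. n - i)"
    by (simp add: edge_list_def length_concat comp_def sum_list_distinct_conv_sum_set
        atLeastLessThanSuc_atLeastAtMost del: upt_Suc)
  also have "\<dots> = (\<Sum>i<n. n - Suc i)" by (simp add: sum.atLeast1_atMost_eq)
  also have "\<dots> = (\<Sum>i<n. i)" by (rule sum.nat_diff_reindex)
  also have "\<dots> = n * (n - 1) div 2" by (simp add: lessThan_atLeast0 Sum_Ico_nat)
  finally show ?thesis .
qed

lemma distinct_edge_list: "distinct (edge_list n)"
  unfolding edge_list_def
  by (rule distinct_concat) (auto simp: distinct_map inj_on_def)

text \<open>Adjacency is a binary digit of \<open>Suc x\<close>, so graph properties can be decided
  from the code. Both orders of \<open>i\<close> and \<open>j\<close> occur because each edge is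
  stored once.\<close>

definition adj :: "nat \<Rightarrow> nat \<Rightarrow> nat \<Rightarrow> nat \<Rightarrow> bool" where
  "adj n x i j \<longleftrightarrow>
     1 \<le> i \<and> i < j \<and> j \<le> n \<and> odd (Suc x div 2 ^ edge_index n i j) \<or>
     1 \<le> j \<and> j < i \<and> i \<le> n \<and> odd (Suc x div 2 ^ edge_index n j i)"

lemma adj_graph_code:
  assumes "labeled_graph n G" shows "adj n (nat_of_bits (graph_code n G)) = G"
proof -
  have *: "odd (Suc (nat_of_bits (graph_code n G)) div 2 ^ edge_index n i j) \<longleftrightarrow> G i j"
    if "1 \<le> i" "i < j" "j \<le> n" for i j
    using nth_edge_list[OF that] by (subst odd_Suc_nat_of_bits_div) (auto simp: graph_code_def)
  show ?thesis
  proof (intro ext)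
    fix i j
    show "adj n (nat_of_bits (graph_code n G)) i j = G i j"
      using assms *[of i j] *[of j i] unfolding adj_def labeled_graph_def
      by (cases i j rule: linorder_cases) (auto simp del: One_nat_def)
  qed
qed

text \<open>A non-neighbour \<^term>\<open>v\<close> of \<^term>\<open>u\<close> is routed through the first neighbour \<^term>\<open>w\<close> of \<^term>\<open>u\<close> that
  is adjacent to \<^term>\<open>v\<close>; the value is the position of \<^term>\<open>w\<close> in the increasing list of neighbours of
  \<^term>\<open>u\<close>, and 0 signals direct delivery.\<close>
definition via :: "nat \<Rightarrow> (nat \<Rightarrow> nat \<Rightarrow> bool) \<Rightarrow> nat \<Rightarrow> nat \<Rightarrow> nat" where
  "via n a u v = (if u = v \<or> a u v then 0
     else \<Sum>w<Suc n. of_bool (a u w \<and> (\<forall>w'<w. \<not> (a u w' \<and> a w' v))))"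

text \<open>Each summand is the length of one unary block with its terminator; \<open>Suc v\<close>
  shifts the range to the destinations 1 to \<open>n\<close>.\<close>

definition long_table :: "nat \<Rightarrow> (nat \<Rightarrow> nat \<Rightarrow> bool) \<Rightarrow> nat \<Rightarrow> bool" where
  "long_table n a u \<longleftrightarrow> 3 * n < (\<Sum>v<n. Suc (via n a u (Suc v)))"

definition far :: "nat \<Rightarrow> (nat \<Rightarrow> nat \<Rightarrow> bool) \<Rightarrow> nat \<Rightarrow> nat \<Rightarrow> bool" where
  "far n a u v \<longleftrightarrow> u \<noteq> v \<and> \<not> a u v \<and> (\<forall>w<Suc n. \<not> (a u w \<and> a w v))"

definition bad :: "nat \<Rightarrow> (nat \<Rightarrow> nat \<Rightarrow> bool) \<Rightarrow> bool" where
  "bad n a \<longleftrightarrow> (\<exists>u<n. long_table n a (Suc u)) \<or> (\<exists>u<n. \<exists>v<n. far n a (Suc u) (Suc v))"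

text \<open>Arbitrary computable arguments make the rule applicable under binders, where variables
  appear as heads and tails of the environment.\<close>

lemma decidable_adj:
  assumes "computable k N" "computable k X" "computable k I" "computable k J"
  shows "decidable k (\<lambda>xs. adj (N xs) (X xs) (I xs) (J xs))"
  unfolding adj_def edge_index_def
  by (intro computable_intros computable_tl computable_hd assms) auto

lemma computable_via_adj:
  assumes "computable k N" "computable k X" "computable k I" "computable k J"
  shows "computable k (\<lambda>xs. via (N xs) (adj (N xs) (X xs)) (I xs) (J xs))"
  unfolding via_def
  by (intro computable_intros decidable_adj computable_tl computable_hd assms) auto

lemma decidable_bad_adj:
  assumes "computable k N" "computable k X"
  shows "decidable k (\<lambda>xs. bad (N xs) (adj (N xs) (X xs)))"
  unfolding bad_def long_table_def far_def
  by (intro computable_intros computable_via_adj decidable_adj computable_tl computable_hd assms) auto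

subsection \<open>The routing schemes\<close>

text \<open>For \<open>w\<close> in \<open>S\<close>, its position in the increasing enumeration,
  counted from 1 so that 0 stays free to mark direct delivery. Ranks serve as port numbers.\<close>

definition rank :: "nat set \<Rightarrow> nat \<Rightarrow> nat" where
  "rank S w = card {w' \<in> S. w' \<le> w}"

lemma bij_betw_rank:
  assumes "finite S" shows "bij_betw (rank S) S {1..card S}"
proof -
  have less: "rank S w < rank S w'" if "w < w'" "w' \<in> S" for w w'
  proof -
    have "w' \<in> {x \<in> S. x \<le> w'}" "w' \<notin> {x \<in> S. x \<le> w}" using that by auto
    then have "{x \<in> S. x \<le> w} \<subset> {x \<in> S. x \<le> w'}" using that by fastforce
    then show ?thesis unfolding rank_def by (rule psubset_card_mono[rotated]) (simp add: assms)
  qed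
  have inj: "inj_on (rank S) S"
    using less by (metis inj_onI linorder_neqE_nat less_irrefl)
  have "rank S w \<in> {1..card S}" if "w \<in> S" for w
    using that assms by (auto simp: rank_def Suc_le_eq card_gt_0_iff intro: card_mono)
  then have "rank S ` S = {1..card S}"
    using inj by (intro card_subset_eq) (auto simp: card_image)
  with inj show ?thesis by (simp add: bij_betw_def)
qed

definition unary :: "nat list \<Rightarrow> bool list" where
  "unary ks = concat (map (\<lambda>k. replicate k True @ [False]) ks)"

text \<open>The first \<open>False\<close> ends the first block, so blocks can be split off one at a
  time.\<close>

lemma inj_unary: "inj unary"
proof (rule injI)
  have replicate_eq: "k = k' \<and> xs = ys"
    if "replicate k True @ False # xs = replicate k' True @ False # ys" for k k' xs ys
    using that
  proof (induction k arbitrary: k')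
    case 0 then show ?case by (cases k') auto
  next
    case (Suc k) then show ?case by (cases k') auto
  qed
  fix ks ks' assume "unary ks = unary ks'"
  then show "ks = ks'"
  proof (induction ks arbitrary: ks')
    case Nil then show ?case by (cases ks') (auto simp: unary_def)
  next
    case (Cons k ks)
    then show ?case by (cases ks') (auto simp: unary_def dest!: replicate_eq)
  qed
qed

lemma length_unary: "length (unary ks) = (\<Sum>k\<leftarrow>ks. Suc k)"
  by (simp add: unary_def length_concat comp_def)

lemma labeled_graphD:
  assumes "labeled_graph n G" "G u v"
  shows "u \<in> {1..n}" "v \<in> {1..n}" "u \<noteq> v" "G v u"
  using assms unfolding labeled_graph_def by blast+

lemma finite_neighbours: "labeled_graph n G \<Longrightarrow> finite {w. G u w}"
  using labeled_graphD(2) by (metis finite_atLeastAtMost finite_subset mem_Collect_eq subsetI)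

text \<open>The sum in \<open>via\<close> counts the neighbours of \<open>u\<close> that no common
  neighbour precedes. These are exactly the neighbours up to the least common neighbour.\<close>

lemma via_eq_rank:
  assumes G: "labeled_graph n G" and uv: "u \<noteq> v" "\<not> G u v" and common: "\<exists>w. G u w \<and> G w v"
  shows "\<exists>w. G u w \<and> G w v \<and> via n G u v = rank {w. G u w} w"
proof -
  define w where "w = (LEAST w. G u w \<and> G w v)"
  have w: "G u w" "G w v" unfolding w_def using LeastI_ex[OF common] by auto
  have "\<not> (G u w' \<and> G w' v)" if "w' < w" for w'
    using that not_less_Least unfolding w_def by blast
  then have "(\<forall>w'<x. \<not> (G u w' \<and> G w' v)) \<longleftrightarrow> x \<le> w" for x
    using w by (meson leD leI less_le_trans)
  then have "{..<Suc n} \<inter> {w. G u w \<and> (\<forall>w'<w. \<not> (G u w' \<and> G w' v))} = {w'. G u w' \<and> w' \<le> w}"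
    using labeled_graphD(2)[OF G, of u] by force
  then have "via n G u v = rank {w. G u w} w"
    using uv by (simp add: via_def rank_def sum_of_bool_eq del: sum.lessThan_Suc)
  with w show ?thesis by blast
qed

text \<open>Ranks of neighbours start at 1, so a destination reached through a common neighbour
  never has entry 0.\<close>

lemma via_eq_0_iff:
  assumes "labeled_graph n G" "u \<noteq> v" "\<not> G u v \<Longrightarrow> \<exists>w. G u w \<and> G w v"
  shows "via n G u v = 0 \<longleftrightarrow> G u v"
proof (cases "G u v")
  case False
  with assms obtain w where w: "G u w" "via n G u v = rank {w. G u w} w"
    using via_eq_rank by metis
  then have "rank {w. G u w} w \<in> {1..card {w. G u w}}"
    using bij_betw_rank[OF finite_neighbours[OF assms(1)], of u] by (auto dest: bij_betwE)
  with w False show ?thesis by simp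
qed (simp add: via_def)

text \<open>All distances are 1 or 2. At distance 2 the first hop reaches a neighbour of
  \<open>v\<close>, where direct delivery takes over.\<close>

lemma shortest_path_routing_diameter_two:
  assumes G: "labeled_graph n G"
    and direct: "\<And>u v. G u v \<Longrightarrow> nxt v u = v"
    and two: "\<And>u v. u \<in> {1..n} \<Longrightarrow> v \<in> {1..n} \<Longrightarrow> u \<noteq> v \<Longrightarrow> \<not> G u v \<Longrightarrow> G u (nxt v u) \<and> G (nxt v u) v"
  shows "shortest_path_routing n G nxt"
  unfolding shortest_path_routing_def
proof (intro ballI impI)
  fix u v assume uv: "u \<in> {1..n}" "v \<in> {1..n}" "u \<noteq> v"
  have walk0: "\<not> walk_of_len G u v 0" using uv by (auto simp: walk_of_len_def)
  have walk1: "walk_of_len G u v (Suc 0) \<longleftrightarrow> G u v"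
    by (auto simp: walk_of_len_def intro: exI[of _ "[u, v]"])
  show "(\<exists>k. walk_of_len G u v k) \<and> (nxt v ^^ gdist G u v) u = v \<and>
      (\<forall>i<gdist G u v. G ((nxt v ^^ i) u) ((nxt v ^^ Suc i) u))"
  proof (cases "G u v")
    case True
    have "gdist G u v = Suc 0"
      unfolding gdist_def
    proof (rule Least_equality)
      fix k assume "walk_of_len G u v k"
      then have "k \<noteq> 0" using walk0 by metis
      then show "Suc 0 \<le> k" by simp
    qed (use walk1 True in simp)
    then show ?thesis using True direct walk1 by auto
  next
    case False
    let ?w = "nxt v u"
    have w: "G u ?w" "G ?w v" using two[OF uv False] by auto
    have walk2: "walk_of_len G u v 2"
      unfolding walk_of_len_def by (rule exI[of _ "[u, ?w, v]"]) (use w in \<open>auto simp: less_2_cases_iff\<close>)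
    have "gdist G u v = 2"
      unfolding gdist_def
    proof (rule Least_equality, rule walk2)
      fix k assume "walk_of_len G u v k"
      then have "k \<noteq> 0" "k \<noteq> Suc 0" using walk0 walk1 False by metis+
      then show "2 \<le> k" by simp
    qed
    then show ?thesis using w direct[OF w(2)] walk2 by (auto simp: less_Suc_eq numeral_2_eq_2)
  qed
qed

definition table :: "nat \<Rightarrow> (nat \<Rightarrow> nat \<Rightarrow> bool) \<Rightarrow> nat \<Rightarrow> bool list" where
  "table n G u = unary (map (\<lambda>v. via n G u (Suc v)) [0..<n])"

definition entry :: "bool list \<Rightarrow> nat \<Rightarrow> nat" where
  "entry m v = inv unary m ! (v - 1)"

lemma entry_table: "v \<in> {1..n} \<Longrightarrow> entry (table n G u) v = via n G u v"
  by (auto simp: entry_def table_def inv_f_f[OF inj_unary])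

lemma length_table: "length (table n G u) = (\<Sum>v<n. Suc (via n G u (Suc v)))"
  by (simp add: table_def length_unary comp_def interv_sum_list_conv_sum_set_nat lessThan_atLeast0)

text \<open>The nodes with entry 0 are the neighbours of \<^term>\<open>x\<close> and \<^term>\<open>x\<close> itself, so the decoder recovers
  the ports of direct neighbours from the table.\<close>
definition IB_decoder :: "nat \<Rightarrow> nat \<Rightarrow> nat \<Rightarrow> bool list \<Rightarrow> nat \<Rightarrow> nat" where
  "IB_decoder n x d m v =
     (if entry m v = 0 then rank {w \<in> {1..n}. w \<noteq> x \<and> entry m w = 0} v else entry m v)"

definition II_decoder :: "nat \<Rightarrow> nat \<Rightarrow> nat set \<Rightarrow> bool list \<Rightarrow> nat \<Rightarrow> nat" where
  "II_decoder n x S m v = (if v \<in> S then v else inv_into S (rank S) (entry m v))"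

context
  fixes n :: nat and G :: "nat \<Rightarrow> nat \<Rightarrow> bool"
  assumes G: "labeled_graph n G" and not_bad: "\<not> bad n G"
begin

lemma common_neighbour:
  assumes "u \<in> {1..n}" "v \<in> {1..n}" "u \<noteq> v" "\<not> G u v"
  shows "\<exists>w. G u w \<and> G w v"
proof -
  have "\<not> far n G (Suc (u - 1)) (Suc (v - 1))"
    using not_bad assms unfolding bad_def by (metis Suc_pred' atLeastAtMost_iff less_eq_Suc_le One_nat_def)
  then show ?thesis using assms by (auto simp: far_def)
qed

lemma length_table_le:
  assumes "u \<in> {1..n}" shows "length (table n G u) \<le> 3 * n"
proof -
  have "\<not> long_table n G (Suc (u - 1))"
    using not_bad assms unfolding bad_def by (metis Suc_pred' atLeastAtMost_iff less_eq_Suc_le One_nat_def)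
  then show ?thesis using assms by (simp add: long_table_def length_table)
qed

text \<open>Ports are ranks, so a nonzero entry is itself the port of a common neighbour. For entry
  0 the port is the rank of \<open>v\<close> in the neighbour set rebuilt from the table.\<close>

lemma IB_decoder_table:
  assumes "x \<in> {1..n}" "v \<in> {1..n}" "x \<noteq> v"
  shows "\<exists>w. G x w \<and> (if G x v then w = v else G w v) \<and>
           IB_decoder n x d (table n G x) v = rank {w. G x w} w"
proof -
  have zero: "entry (table n G x) w = 0 \<longleftrightarrow> G x w" if "w \<in> {1..n}" "x \<noteq> w" for w
    using via_eq_0_iff[OF G that(2)] common_neighbour[OF assms(1) that] that(1)
    by (simp add: entry_table)
  have "{w \<in> {1..n}. w \<noteq> x \<and> entry (table n G x) w = 0} = {w. G x w}"
    using zero labeled_graphD(2,3)[OF G, of x] by blast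
  then show ?thesis
    using assms zero[OF assms(2,3)] via_eq_rank[OF G assms(3)] common_neighbour[OF assms]
    by (auto simp: IB_decoder_def entry_table)
qed

lemma II_decoder_table:
  assumes "x \<in> {1..n}" "v \<in> {1..n}" "x \<noteq> v"
  shows "\<exists>w. G x w \<and> (if G x v then w = v else G w v) \<and>
           II_decoder n x {w. G x w} (table n G x) v = w"
proof (cases "G x v")
  case False
  with assms obtain w where "G x w" "G w v" "via n G x v = rank {w. G x w} w"
    using via_eq_rank[OF G assms(3)] common_neighbour by metis
  moreover from this have "inv_into {w. G x w} (rank {w. G x w}) (rank {w. G x w} w) = w"
    using bij_betw_rank[OF finite_neighbours[OF G]] by (intro inv_into_f_f) (auto simp: bij_betw_def)
  ultimately show ?thesis using False assms by (simp add: II_decoder_def entry_table)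
qed (auto simp: II_decoder_def)

lemma IB_scheme_table: "IB_scheme IB_decoder n G (\<lambda>x. rank {w. G x w}) (table n G)"
proof -
  have bij: "bij_betw (rank {w. G x w}) {w. G x w} {1..deg G x}" for x
    unfolding deg_def by (rule bij_betw_rank[OF finite_neighbours[OF G]])
  let ?nxt = "\<lambda>v x. inv_into {w. G x w} (rank {w. G x w}) (IB_decoder n x (deg G x) (table n G x) v)"
  have nxt: "G x (?nxt v x) \<and> (if G x v then ?nxt v x = v else G (?nxt v x) v)"
    if xv: "x \<in> {1..n}" "v \<in> {1..n}" "x \<noteq> v" for x v
  proof -
    obtain w where w: "G x w" "if G x v then w = v else G w v"
      "IB_decoder n x (deg G x) (table n G x) v = rank {w. G x w} w"
      using IB_decoder_table[OF xv] by blast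
    then have nxt_eq: "?nxt v x = w"
      using bij[of x] by (simp add: bij_betw_def)
    show ?thesis unfolding nxt_eq using w by simp
  qed
  have "IB_decoder n x (deg G x) (table n G x) v \<in> {1..deg G x}"
    if xv: "x \<in> {1..n}" "v \<in> {1..n}" "x \<noteq> v" for x v
    using IB_decoder_table[OF xv, of "deg G x"] bij[of x] by (auto dest: bij_betwE)
  moreover have "shortest_path_routing n G ?nxt"
  proof (rule shortest_path_routing_diameter_two[OF G])
    fix u v assume "G u v" then show "?nxt v u = v"
      using nxt[of u v] labeled_graphD[OF G, of u v] by auto
  qed (use nxt in metis)
  ultimately show ?thesis
    using bij unfolding IB_scheme_def port_assignment_def by blast
qed

lemma II_scheme_table: "II_scheme II_decoder n G (table n G)"
  unfolding II_scheme_def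
proof (rule shortest_path_routing_diameter_two[OF G])
  fix u v assume "G u v"
  then show "II_decoder n u {w. G u w} (table n G u) v = v" by (simp add: II_decoder_def)
qed (use II_decoder_table in metis)

end

subsection \<open>Averages over random edge sets\<close>

text \<open>For finite \<open>Z\<close>, the expectation of \<open>f\<close> at a uniformly random
  subset: each element is included by an independent fair coin flip.\<close>

definition avg :: "'a set \<Rightarrow> ('a set \<Rightarrow> real) \<Rightarrow> real" where
  "avg Z f = (\<Sum>A\<in>Pow Z. f A) / 2 ^ card Z"

lemma avg_cong: "(\<And>A. A \<subseteq> Z \<Longrightarrow> f A = g A) \<Longrightarrow> avg Z f = avg Z g"
  by (simp add: avg_def)

lemma avg_mono: "(\<And>A. A \<subseteq> Z \<Longrightarrow> f A \<le> g A) \<Longrightarrow> avg Z f \<le> avg Z g"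
  by (auto simp: avg_def intro!: divide_right_mono sum_mono)

lemma avg_const: "finite Z \<Longrightarrow> avg Z (\<lambda>_. c) = c"
  by (simp add: avg_def card_Pow)

lemma avg_empty: "avg {} f = f {}"
  by (simp add: avg_def)

lemma avg_mult_left: "avg Z (\<lambda>A. c * f A) = c * avg Z f"
  by (simp add: avg_def sum_distrib_left)

lemma avg_mult_right: "avg Z (\<lambda>A. f A * c) = avg Z f * c"
  by (simp add: avg_def sum_distrib_right)

lemma avg_add: "avg Z (\<lambda>A. f A + g A) = avg Z f + avg Z g"
  by (simp add: avg_def sum.distrib add_divide_distrib)

lemma avg_sum: "avg Z (\<lambda>A. \<Sum>i\<in>I. f i A) = (\<Sum>i\<in>I. avg Z (f i))"
  unfolding avg_def by (subst sum.swap) (simp add: sum_divide_distrib)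

lemma avg_of_bool:
  assumes "finite Z" shows "avg Z (\<lambda>A. of_bool (P A)) = card {A. A \<subseteq> Z \<and> P A} / 2 ^ card Z"
proof -
  have "Pow Z \<inter> {A. P A} = {A. A \<subseteq> Z \<and> P A}" by auto
  then show ?thesis using assms by (simp add: avg_def sum_of_bool_eq)
qed

lemma avg_insert:
  assumes "finite Z" "a \<notin> Z"
  shows "avg (insert a Z) f = (avg Z (\<lambda>A. f (insert a A)) + avg Z f) / 2"
proof -
  have inj: "inj_on (insert a) (Pow Z)" using assms(2) by (auto simp: inj_on_def)
  have "(\<Sum>A\<in>Pow (insert a Z). f A) = (\<Sum>A\<in>Pow Z. f A) + (\<Sum>A\<in>insert a ` Pow Z. f A)"
    unfolding Pow_insert using assms by (intro sum.union_disjoint) auto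
  also have "(\<Sum>A\<in>insert a ` Pow Z. f A) = (\<Sum>A\<in>Pow Z. f (insert a A))"
    using inj by (simp add: sum.reindex)
  finally show ?thesis using assms by (simp add: avg_def add_divide_distrib)
qed

text \<open>The traces of a random set on disjoint ground sets are independent, so the expectation
  can be taken in two stages.\<close>

lemma avg_Un:
  assumes "finite X" "finite Y" "X \<inter> Y = {}"
  shows "avg (X \<union> Y) (\<lambda>A. f (A \<inter> X) (A \<inter> Y)) = avg X (\<lambda>B. avg Y (f B))"
  using assms
proof (induction X arbitrary: f rule: finite_induct)
  case empty
  have "avg Y (\<lambda>A. f {} (A \<inter> Y)) = avg Y (f {})" by (rule avg_cong) (simp add: Int_absorb2)
  then show ?case by (simp add: avg_empty)
next
  case (insert a X)
  have "avg (X \<union> Y) (\<lambda>A. f (insert a A \<inter> insert a X) (insert a A \<inter> Y))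
      = avg (X \<union> Y) (\<lambda>A. f (insert a (A \<inter> X)) (A \<inter> Y))"
    using insert.prems by (intro avg_cong arg_cong2[of _ _ _ _ f]) auto
  also have "\<dots> = avg X (\<lambda>B. avg Y (f (insert a B)))"
    using insert.prems by (intro insert.IH) auto
  finally have 1: "avg (X \<union> Y) (\<lambda>A. f (insert a A \<inter> insert a X) (insert a A \<inter> Y))
      = avg X (\<lambda>B. avg Y (f (insert a B)))" .
  have "avg (X \<union> Y) (\<lambda>A. f (A \<inter> insert a X) (A \<inter> Y)) = avg (X \<union> Y) (\<lambda>A. f (A \<inter> X) (A \<inter> Y))"
    using insert by (intro avg_cong arg_cong2[of _ _ _ _ f]) auto
  also have "\<dots> = avg X (\<lambda>B. avg Y (f B))"
    using insert.prems by (intro insert.IH) auto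
  finally have 2: "avg (X \<union> Y) (\<lambda>A. f (A \<inter> insert a X) (A \<inter> Y)) = avg X (\<lambda>B. avg Y (f B))" .
  have "avg (insert a (X \<union> Y)) (\<lambda>A. f (A \<inter> insert a X) (A \<inter> Y))
      = (avg X (\<lambda>B. avg Y (f (insert a B))) + avg X (\<lambda>B. avg Y (f B))) / 2"
    using insert by (subst avg_insert) (simp_all only: 1 2, auto)
  also have "\<dots> = avg (insert a X) (\<lambda>B. avg Y (f B))"
    using insert by (simp add: avg_insert)
  finally show ?case by simp
qed

text \<open>Factors that depend on pairwise disjoint parts of the random set are independent. The
  induction splits off \<open>E v\<close> and continues on \<open>Z - E v\<close>, hence
  \<open>Z\<close> is generalized.\<close>

lemma avg_prod:
  assumes "finite V" "finite Z" "\<And>v. v \<in> V \<Longrightarrow> E v \<subseteq> Z"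
    and "\<And>v w. v \<in> V \<Longrightarrow> w \<in> V \<Longrightarrow> v \<noteq> w \<Longrightarrow> E v \<inter> E w = {}"
  shows "avg Z (\<lambda>A. \<Prod>v\<in>V. g v (A \<inter> E v)) = (\<Prod>v\<in>V. avg (E v) (g v))"
  using assms
proof (induction V arbitrary: Z rule: finite_induct)
  case empty then show ?case by (simp add: avg_const)
next
  case (insert v V)
  have Ev: "E v \<subseteq> Z" using insert.prems by auto
  have disj: "E v \<inter> E w = {}" if "w \<in> V" for w
    using insert.prems(3)[of v w] insert.hyps that by auto
  have "avg Z (\<lambda>A. \<Prod>w\<in>insert v V. g w (A \<inter> E w))
      = avg Z (\<lambda>A. g v (A \<inter> E v) * (\<Prod>w\<in>V. g w ((A \<inter> (Z - E v)) \<inter> E w)))"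
  proof (rule avg_cong)
    fix A assume "A \<subseteq> Z"
    then have "A \<inter> (Z - E v) \<inter> E w = A \<inter> E w" if "w \<in> V" for w using disj[OF that] by auto
    then show "(\<Prod>w\<in>insert v V. g w (A \<inter> E w))
        = g v (A \<inter> E v) * (\<Prod>w\<in>V. g w ((A \<inter> (Z - E v)) \<inter> E w))"
      using insert.hyps by simp
  qed
  also have "\<dots> = avg (E v \<union> (Z - E v)) (\<lambda>A. g v (A \<inter> E v) * (\<Prod>w\<in>V. g w ((A \<inter> (Z - E v)) \<inter> E w)))"
    using Ev by (simp add: Un_absorb1)
  also have "\<dots> = avg (E v) (\<lambda>B. avg (Z - E v) (\<lambda>C. g v B * (\<Prod>w\<in>V. g w (C \<inter> E w))))"
    using insert.prems(1) Ev by (intro avg_Un) (auto intro: finite_subset)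
  also have "\<dots> = avg (E v) (g v) * avg (Z - E v) (\<lambda>C. \<Prod>w\<in>V. g w (C \<inter> E w))"
    by (simp add: avg_mult_left avg_mult_right)
  also have "avg (Z - E v) (\<lambda>C. \<Prod>w\<in>V. g w (C \<inter> E w)) = (\<Prod>w\<in>V. avg (E w) (g w))"
    using insert.prems disj by (intro insert.IH) blast+
  finally show ?case using insert.hyps by simp
qed

text \<open>The cardinality is the position of the first hit, truncated at \<^term>\<open>card S\<close>: it is dominated by
  a geometric variable \<^term>\<open>X\<close> with parameter 1/2, for which the expectation of $(4/3)^X$ is 2.\<close>
lemma avg_first_hit_le:
  fixes S :: "nat set"
  assumes "finite S" "inj_on h S"
  shows "avg (h ` S) (\<lambda>C. (4/3) ^ card {w \<in> S. \<forall>w'\<in>S. w' < w \<longrightarrow> h w' \<notin> C}) \<le> 2"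
  using assms
proof (induction S rule: finite_linorder_min_induct)
  case empty then show ?case by (simp add: avg_const)
next
  case (insert m S)
  have m: "m \<notin> S" using insert.hyps by auto
  have hm: "h m \<notin> h ` S" using insert.prems m by (auto simp: inj_on_def)
  let ?I = "\<lambda>C. {w \<in> S. \<forall>w'\<in>S. w' < w \<longrightarrow> h w' \<notin> C}"
  let ?J = "\<lambda>C. {w \<in> insert m S. \<forall>w'\<in>insert m S. w' < w \<longrightarrow> h w' \<notin> C}"
  have hit: "?J (insert (h m) C) = {m}" for C
    using insert.hyps by auto
  have miss: "card (?J C) = Suc (card (?I C))" if "C \<subseteq> h ` S" for C
  proof -
    have "?J C = insert m (?I C)" using insert.hyps hm that by auto
    then show ?thesis using m insert.hyps by simp
  qed
  \<comment> \<open>\<open>m\<close> is smaller than all of \<open>S\<close>. Conditioning on its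
    coin, a hit leaves exponent 1 and a miss adds 1 to the exponent for \<open>S\<close>. The bound
    2 is the fixed point of \<open>x = (4/3 + 4/3 * x) / 2\<close>.\<close>
  have "avg (h ` insert m S) (\<lambda>C. (4/3) ^ card (?J C))
      = (avg (h ` S) (\<lambda>C. 4/3) + avg (h ` S) (\<lambda>C. (4/3) ^ card (?J C))) / 2"
    unfolding image_insert avg_insert[OF finite_imageI[OF insert.hyps(1)] hm] hit by simp
  also have "avg (h ` S) (\<lambda>C. (4/3) ^ card (?J C)) = avg (h ` S) (\<lambda>C. 4/3 * (4/3) ^ card (?I C))"
    by (rule avg_cong) (simp only: miss power_Suc)
  also have "\<dots> = 4/3 * avg (h ` S) (\<lambda>C. (4/3) ^ card (?I C))"
    by (rule avg_mult_left)
  also have "(avg (h ` S) (\<lambda>C. 4/3) + 4/3 * avg (h ` S) (\<lambda>C. (4/3) ^ card (?I C))) / 2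
      \<le> (4/3 + 4/3 * 2) / 2"
    using insert by (simp add: avg_const)
  finally show ?case by simp
qed

subsection \<open>Counting bad graphs\<close>

definition edge :: "nat \<Rightarrow> nat \<Rightarrow> nat \<times> nat" where
  "edge u v = (min u v, max u v)"

definition graph_of :: "(nat \<times> nat) set \<Rightarrow> nat \<Rightarrow> nat \<Rightarrow> bool" where
  "graph_of A u v \<longleftrightarrow> u \<noteq> v \<and> edge u v \<in> A"

lemma edge_eq_iff: "edge u v = edge x y \<longleftrightarrow> u = x \<and> v = y \<or> u = y \<and> v = x"
  by (auto simp: edge_def min_def max_def)

lemma edge_commute: "edge u v = edge v u"
  by (simp add: edge_eq_iff)

lemma edge_mem: "u \<noteq> v \<Longrightarrow> edge u v \<in> set (edge_list n) \<longleftrightarrow> u \<in> {1..n} \<and> v \<in> {1..n}"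
  by (auto simp: edge_def set_edge_list min_def max_def)

lemma labeled_graph_graph_of: "A \<subseteq> set (edge_list n) \<Longrightarrow> labeled_graph n (graph_of A)"
  unfolding labeled_graph_def graph_of_def using edge_mem edge_commute by (metis subsetD)

text \<open>Each of the \<open>n - 2\<close> other nodes fails to be a common neighbour with
  probability 3/4, independently since the edge pairs are disjoint. The factor 16/9 turns the
  exponent \<open>n - 2\<close> into \<open>n\<close>.\<close>

lemma avg_far_le:
  assumes "u \<in> {1..n}" "v \<in> {1..n}"
  shows "avg (set (edge_list n)) (\<lambda>A. of_bool (far n (graph_of A) u v)) \<le> 16/9 * (3/4) ^ n"
proof (cases "u = v")
  case True then show ?thesis by (simp add: far_def avg_const)
next
  case False
  define V where "V = {1..n} - {u, v}"
  have cardV: "card V = n - 2" using assms False by (simp add: V_def card_Diff_subset)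
  define E where "E w = {edge u w, edge v w}" for w
  define g :: "nat \<Rightarrow> (nat \<times> nat) set \<Rightarrow> real"
    where "g w B = of_bool (\<not> (edge u w \<in> B \<and> edge v w \<in> B))" for w B
  have avg_g: "avg (E w) (g w) = 3/4" for w
  proof -
    have "edge u w \<noteq> edge v w" using False by (auto simp: edge_eq_iff)
    then show ?thesis
      by (simp add: E_def avg_insert) (simp add: avg_def g_def)
  qed
  have "avg (set (edge_list n)) (\<lambda>A. of_bool (far n (graph_of A) u v))
      \<le> avg (set (edge_list n)) (\<lambda>A. \<Prod>w\<in>V. g w (A \<inter> E w))"
  proof (rule avg_mono)
    fix A
    have "g w (A \<inter> E w) = 1" if "far n (graph_of A) u v" "w \<in> V" for w
    proof -
      have "\<not> (graph_of A u w \<and> graph_of A w v)" "w \<noteq> u" "w \<noteq> v"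
        using that by (auto simp: far_def V_def)
      then show ?thesis by (auto simp: graph_of_def g_def edge_commute[of w])
    qed
    then show "of_bool (far n (graph_of A) u v) \<le> (\<Prod>w\<in>V. g w (A \<inter> E w))"
      by (cases "far n (graph_of A) u v") (auto simp: g_def intro: prod_nonneg)
  qed
  also have "\<dots> = (\<Prod>w\<in>V. avg (E w) (g w))"
    using assms False by (intro avg_prod) (auto simp: V_def E_def edge_mem edge_eq_iff)
  also have "\<dots> = (3/4) ^ (n - 2)" by (simp add: avg_g cardV)
  also have "\<dots> = 16/9 * (3/4) ^ n"
  proof -
    have "2 \<le> n" using assms False by auto
    then show ?thesis by (simp add: power_diff power2_eq_square)
  qed
  finally show ?thesis by simp
qed

text \<open>Once the edges at \<open>u\<close> fix the candidates \<open>S\<close>, the entry is a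
  first-hit count over the edges from \<open>S\<close> to \<open>v\<close>, as in
  \<open>avg_first_hit_le\<close>.\<close>

lemma via_graph_of:
  assumes A: "A \<subseteq> set (edge_list n)" and uv: "u \<noteq> v" "edge u v \<notin> A"
    and S: "S = {w \<in> {1..n} - {u}. edge u w \<in> A}"
  shows "via n (graph_of A) u v = card {w \<in> S. \<forall>w'\<in>S. w' < w \<longrightarrow> edge w' v \<notin> A}"
proof -
  have nbr: "graph_of A u w \<longleftrightarrow> w \<in> S" for w
    using A edge_mem[of u w n] by (auto simp: graph_of_def S)
  have "v \<notin> S" using uv S by simp
  then have hit: "graph_of A u w' \<and> graph_of A w' v \<longleftrightarrow> w' \<in> S \<and> edge w' v \<in> A" for w'
    unfolding nbr by (auto simp: graph_of_def)
  have "{..<Suc n} \<inter> {w. w \<in> S \<and> (\<forall>w'<w. \<not> (w' \<in> S \<and> edge w' v \<in> A))}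
      = {w \<in> S. \<forall>w'\<in>S. w' < w \<longrightarrow> edge w' v \<notin> A}"
    by (auto simp: S)
  moreover have "\<not> graph_of A u v" using uv by (simp add: graph_of_def)
  ultimately show ?thesis
    using uv(1) by (simp add: via_def hit sum_of_bool_eq del: sum.lessThan_Suc) (simp add: nbr)
qed

text \<open>Condition on the star \<open>X\<close> of edges at \<open>u\<close>. Given the star, a
  neighbour contributes the factor 4/3 and a non-neighbour at most 8/3 on average; the fair coin for
  the edge to \<open>u\<close> averages these to 2 per destination.\<close>

lemma avg_table_le:
  assumes u: "u \<in> {1..n}"
  shows "avg (set (edge_list n)) (\<lambda>A. (4/3) ^ (\<Sum>v\<in>{1..n}. Suc (via n (graph_of A) u v))) \<le> 2 ^ n"
proof -
  define z :: real where "z = 4/3"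
  define W where "W = {1..n} - {u}"
  define X where "X = edge u ` W"
  define Y where "Y = set (edge_list n) - X"
  define S where "S B = {w \<in> W. edge u w \<in> B}" for B
  define I where "I S v C = card {w \<in> S. \<forall>w'\<in>S. w' < w \<longrightarrow> edge w' v \<notin> C}"
    for S v and C :: "(nat \<times> nat) set"
  \<comment> \<open>The leading \<open>z\<close> is the entry of \<open>u\<close> itself, which is 0
    and costs one bit.\<close>
  define f where "f B C = z * (\<Prod>v\<in>S B. z) * (\<Prod>v\<in>W - S B. z * z ^ I (S B) v C)" for B C
  have fin: "finite W" "finite X" "finite Y" by (auto simp: W_def X_def Y_def)
  have finS: "finite (S B)" "S B \<subseteq> W" for B using fin by (auto simp: S_def)
  have X_sub: "X \<subseteq> set (edge_list n)"
    unfolding X_def W_def using u by (auto simp: image_subset_iff edge_mem)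
  then have XY: "X \<union> Y = set (edge_list n)" by (auto simp: Y_def)
  have step: "z ^ (\<Sum>v\<in>{1..n}. Suc (via n (graph_of A) u v)) = f (A \<inter> X) (A \<inter> Y)"
    if A: "A \<subseteq> set (edge_list n)" for A
  proof -
    have SA: "S (A \<inter> X) = {w \<in> {1..n} - {u}. edge u w \<in> A}"
      by (auto simp: S_def X_def W_def)
    have "{1..n} = insert u W" "u \<notin> W" using u by (auto simp: W_def)
    then have "z ^ (\<Sum>v\<in>{1..n}. Suc (via n (graph_of A) u v))
        = z * z ^ (\<Sum>v\<in>W. Suc (via n (graph_of A) u v))"
      using fin by (simp add: via_def[of _ _ u u])
    also have "z ^ (\<Sum>v\<in>W. Suc (via n (graph_of A) u v)) = (\<Prod>v\<in>W. z ^ Suc (via n (graph_of A) u v))"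
      by (rule power_sum)
    also have "(\<Prod>v\<in>W. z ^ Suc (via n (graph_of A) u v)) =
        (\<Prod>v\<in>S (A \<inter> X). z ^ Suc (via n (graph_of A) u v)) *
        (\<Prod>v\<in>W - S (A \<inter> X). z ^ Suc (via n (graph_of A) u v))"
      using fin finS by (subst prod.subset_diff[of "S (A \<inter> X)"]) (simp_all add: mult.commute)
    also have "(\<Prod>v\<in>S (A \<inter> X). z ^ Suc (via n (graph_of A) u v)) = (\<Prod>v\<in>S (A \<inter> X). z)"
      by (rule prod.cong) (auto simp: SA via_def graph_of_def)
    also have "(\<Prod>v\<in>W - S (A \<inter> X). z ^ Suc (via n (graph_of A) u v))
        = (\<Prod>v\<in>W - S (A \<inter> X). z * z ^ I (S (A \<inter> X)) v (A \<inter> Y))"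
    proof (rule prod.cong[OF refl])
      fix v assume v: "v \<in> W - S (A \<inter> X)"
      then have uv: "u \<noteq> v" "edge u v \<notin> A" by (auto simp: W_def SA)
      \<comment> \<open>Edges between two nodes other than \<open>u\<close> avoid the star, so
        restricting to \<open>Y\<close> loses none of them.\<close>
      have "edge w v \<notin> X" if "w \<in> W" for w
        using that v by (auto simp: X_def W_def edge_eq_iff)
      then have "edge w v \<in> A \<inter> Y \<longleftrightarrow> edge w v \<in> A" if "w \<in> W" for w
        using that A by (auto simp: Y_def)
      then have "via n (graph_of A) u v = I (S (A \<inter> X)) v (A \<inter> Y)"
        unfolding via_graph_of[OF A uv SA] I_def
        by (intro arg_cong[of _ _ card] Collect_cong) (auto simp: S_def)
      then show "z ^ Suc (via n (graph_of A) u v) = z * z ^ I (S (A \<inter> X)) v (A \<inter> Y)" by simp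
    qed
    finally show ?thesis by (simp add: f_def mult.assoc)
  qed
  have inner: "avg Y (f B) \<le> z * (\<Prod>v\<in>W. if edge u v \<in> B then z else z * 2)" for B
  proof -
    \<comment> \<open>The candidate edges at \<open>v\<close>. For distinct non-neighbours
      \<open>v\<close> and \<open>v'\<close> these sets are disjoint: a shared edge would be
      \<open>edge v v'\<close>, making \<open>v\<close> and \<open>v'\<close> candidates, that is,
      members of \<open>S B\<close>.\<close>
    define E where "E v = (\<lambda>w. edge w v) ` S B" for v
    have "avg Y (f B) = z * (\<Prod>v\<in>S B. z) * avg Y (\<lambda>C. \<Prod>v\<in>W - S B. z * z ^ I (S B) v (C \<inter> E v))"
      unfolding avg_mult_left[symmetric] f_def
      by (intro avg_cong arg_cong2[of _ _ _ _ "(*)"] prod.cong refl arg_cong[of _ _ "(^) z"])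
        (auto simp: I_def E_def intro!: arg_cong[of _ _ card])
    also have "avg Y (\<lambda>C. \<Prod>v\<in>W - S B. z * z ^ I (S B) v (C \<inter> E v))
        = (\<Prod>v\<in>W - S B. avg (E v) (\<lambda>C. z * z ^ I (S B) v C))"
    proof (rule avg_prod)
      fix v assume v: "v \<in> W - S B"
      then have "w \<noteq> v \<and> edge w v \<notin> X" if "w \<in> S B" for w
        using that finS(2)[of B] by (auto simp: X_def W_def edge_eq_iff)
      then show "E v \<subseteq> Y"
        using v finS(2)[of B] by (auto simp: E_def Y_def W_def edge_mem)
    qed (use fin in \<open>auto simp: E_def edge_eq_iff\<close>)
    also have "\<dots> \<le> (\<Prod>v\<in>W - S B. z * 2)"
    proof (intro prod_mono conjI)
      fix v assume "v \<in> W - S B"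
      show "0 \<le> avg (E v) (\<lambda>C. z * z ^ I (S B) v C)"
        by (auto simp: avg_def z_def intro!: divide_nonneg_nonneg sum_nonneg)
      have "inj_on (\<lambda>w. edge w v) (S B)" by (auto simp: inj_on_def edge_eq_iff)
      from avg_first_hit_le[OF finS(1) this]
      show "avg (E v) (\<lambda>C. z * z ^ I (S B) v C) \<le> z * 2"
        unfolding avg_mult_left E_def I_def z_def by (intro mult_left_mono) auto
    qed
    also have "(\<Prod>v\<in>W - S B. z * 2) = (\<Prod>v\<in>W - S B. if edge u v \<in> B then z else z * 2)"
      by (rule prod.cong) (auto simp: S_def)
    also have "(\<Prod>v\<in>S B. z) = (\<Prod>v\<in>S B. if edge u v \<in> B then z else z * 2)"
      by (rule prod.cong) (auto simp: S_def)
    also have "z * (\<Prod>v\<in>S B. if edge u v \<in> B then z else z * 2)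
          * (\<Prod>v\<in>W - S B. if edge u v \<in> B then z else z * 2)
        = z * (\<Prod>v\<in>W. if edge u v \<in> B then z else z * 2)"
      using prod.subset_diff[OF finS(2)[of B] fin(1), of "\<lambda>v. if edge u v \<in> B then z else z * 2"]
      by (simp add: mult.commute mult.left_commute)
    finally show ?thesis by (simp add: z_def mult_left_mono prod_nonneg)
  qed
  have "avg (set (edge_list n)) (\<lambda>A. z ^ (\<Sum>v\<in>{1..n}. Suc (via n (graph_of A) u v)))
      = avg (X \<union> Y) (\<lambda>A. f (A \<inter> X) (A \<inter> Y))"
    unfolding XY by (rule avg_cong) (rule step)
  also have "\<dots> = avg X (\<lambda>B. avg Y (f B))"
    by (rule avg_Un) (use fin in \<open>auto simp: Y_def\<close>)
  \<comment> \<open>Intersecting with \<open>{edge u v}\<close> exhibits each factor as depending on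
    a single coin, the form required by \<open>avg_prod\<close>.\<close>
  also have "\<dots> \<le> avg X (\<lambda>B. z * (\<Prod>v\<in>W. if edge u v \<in> B \<inter> {edge u v} then z else z * 2))"
    using inner by (intro avg_mono) simp
  also have "\<dots> = z * (\<Prod>v\<in>W. avg {edge u v} (\<lambda>B. if edge u v \<in> B then z else z * 2))"
    unfolding avg_mult_left
    by (subst avg_prod[where E = "\<lambda>v. {edge u v}"]) (use fin in \<open>auto simp: X_def edge_eq_iff\<close>)
  also have "\<dots> = z * 2 ^ (n - 1)"
    using u by (simp add: avg_insert avg_empty z_def W_def card_Diff_subset)
  also have "\<dots> \<le> 2 * 2 ^ (n - 1)" by (simp add: z_def)
  also have "\<dots> = 2 ^ n" using u by (simp flip: power_Suc)
  finally show ?thesis by (simp add: z_def)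
qed

text \<open>Markov's inequality for the exponential moment with base 4/3; the bound is
  \<open>(3/4) ^ 3 * 2 = 27/32\<close> per node.\<close>

lemma avg_long_table_le:
  assumes "u \<in> {1..n}"
  shows "avg (set (edge_list n)) (\<lambda>A. of_bool (long_table n (graph_of A) u)) \<le> (27/32) ^ n"
proof -
  let ?T = "\<lambda>A. \<Sum>v\<in>{1..n}. Suc (via n (graph_of A) u v)"
  have "avg (set (edge_list n)) (\<lambda>A. of_bool (long_table n (graph_of A) u))
      \<le> avg (set (edge_list n)) (\<lambda>A. (3/4) ^ (3 * n) * (4/3) ^ ?T A)"
  proof (rule avg_mono)
    fix A
    have "(1::real) \<le> (3/4) ^ (3 * n) * (4/3) ^ T" if "3 * n < T" for T
    proof -
      have "(3/4) ^ (3 * n) * (4/3) ^ (3 * n) \<le> (3/4) ^ (3 * n) * ((4/3::real) ^ T)"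
        using that by (intro mult_left_mono power_increasing) auto
      then show ?thesis by (simp flip: power_mult_distrib)
    qed
    then show "of_bool (long_table n (graph_of A) u) \<le> (3/4) ^ (3 * n) * (4/3::real) ^ ?T A"
      by (simp add: long_table_def sum.atLeast1_atMost_eq)
  qed
  also have "\<dots> \<le> (3/4) ^ (3 * n) * 2 ^ n"
    unfolding avg_mult_left using avg_table_le[OF assms] by (intro mult_left_mono) auto
  also have "\<dots> = ((3/4) ^ 3 * 2) ^ n" by (simp only: power_mult power_mult_distrib)
  also have "\<dots> = (27/32) ^ n" by (simp add: power3_eq_cube)
  finally show ?thesis .
qed

definition bad_bound :: "nat \<Rightarrow> real" where
  "bad_bound n = real n * (27/32) ^ n + (real n)\<^sup>2 * (16/9 * (3/4) ^ n)"

text \<open>Union bound over \<open>n\<close> tables and \<open>n * n\<close> ordered pairs.\<close>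

lemma avg_bad_le: "avg (set (edge_list n)) (\<lambda>A. of_bool (bad n (graph_of A))) \<le> bad_bound n"
proof -
  have "avg (set (edge_list n)) (\<lambda>A. of_bool (bad n (graph_of A)))
      \<le> avg (set (edge_list n)) (\<lambda>A. (\<Sum>u<n. of_bool (long_table n (graph_of A) (Suc u)))
          + (\<Sum>u<n. \<Sum>v<n. of_bool (far n (graph_of A) (Suc u) (Suc v))))"
  proof (rule avg_mono)
    fix A
    let ?L = "\<lambda>u. of_bool (long_table n (graph_of A) (Suc u)) :: real"
    let ?F = "\<lambda>u v. of_bool (far n (graph_of A) (Suc u) (Suc v)) :: real"
    have "1 \<le> (\<Sum>u<n. ?L u)" if "u < n" "long_table n (graph_of A) (Suc u)" for u
      using member_le_sum[of u "{..<n}" ?L] that by simp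
    moreover have "1 \<le> (\<Sum>u<n. \<Sum>v<n. ?F u v)"
      if "u < n" "v < n" "far n (graph_of A) (Suc u) (Suc v)" for u v
    proof -
      have "1 \<le> (\<Sum>v<n. ?F u v)" using member_le_sum[of v "{..<n}" "?F u"] that by simp
      also have "\<dots> \<le> (\<Sum>u<n. \<Sum>v<n. ?F u v)"
        using that by (intro member_le_sum[of u "{..<n}" "\<lambda>u. \<Sum>v<n. ?F u v"] sum_nonneg) auto
      finally show ?thesis .
    qed
    moreover have "0 \<le> (\<Sum>u<n. ?L u)" "0 \<le> (\<Sum>u<n. \<Sum>v<n. ?F u v)"
      by (intro sum_nonneg; simp)+
    ultimately show "of_bool (bad n (graph_of A)) \<le> (\<Sum>u<n. ?L u) + (\<Sum>u<n. \<Sum>v<n. ?F u v)"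
      unfolding bad_def by (fastforce simp: of_bool_def)
  qed
  also have "\<dots> \<le> (\<Sum>u<n. (27/32) ^ n) + (\<Sum>u<n. \<Sum>v<n. 16/9 * (3/4) ^ n)"
    unfolding avg_add avg_sum
    by (intro add_mono sum_mono avg_long_table_le avg_far_le) auto
  finally show ?thesis by (simp add: bad_bound_def power2_eq_square mult.assoc)
qed

subsection \<open>Incompressibility\<close>

text \<open>The two inequalities say that \<open>x\<close> codes a bit string of the length of a
  graph code, so only finitely many \<open>x\<close> qualify for each \<open>n\<close>.\<close>

definition bad_code :: "nat \<Rightarrow> nat \<Rightarrow> bool" where
  "bad_code n x \<longleftrightarrow> 2 ^ (n * (n - 1) div 2) \<le> Suc x \<and> Suc x < 2 ^ Suc (n * (n - 1) div 2) \<and>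
     bad n (adj n x)"

lemma decidable_bad_code:
  assumes "computable k N" "computable k X"
  shows "decidable k (\<lambda>xs. bad_code (N xs) (X xs))"
  unfolding bad_code_def by (intro computable_intros decidable_bad_adj assms)

lemma length_graph_code: "length (graph_code n G) = n * (n - 1) div 2"
  by (simp add: graph_code_def length_edge_list)

lemma bad_code_graph_code:
  assumes "labeled_graph n G" "bad n G"
  shows "bad_code n (nat_of_bits (graph_code n G))"
  using assms nat_of_bits_bounds[of "graph_code n G"]
  by (simp add: bad_code_def adj_graph_code length_graph_code)

text \<open>Every string of the right length comes from an edge set, so bad codes can be counted by
  bad edge sets.\<close>

lemma graph_code_surj:
  assumes "length bs = length (edge_list n)"
  obtains A where "A \<subseteq> set (edge_list n)" "graph_code n (graph_of A) = bs"
proof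
  let ?A = "{edge_list n ! k |k. k < length bs \<and> bs ! k}"
  show "?A \<subseteq> set (edge_list n)" using assms by auto
  have "(case edge_list n ! k of (i, j) \<Rightarrow> graph_of ?A i j) = bs ! k" if k: "k < length bs" for k
  proof -
    obtain i j where ij: "edge_list n ! k = (i, j)" by fastforce
    have "(i, j) \<in> set (edge_list n)" using ij k assms by (metis nth_mem)
    then have "graph_of ?A i j \<longleftrightarrow> (i, j) \<in> ?A"
      by (auto simp: graph_of_def edge_def set_edge_list)
    also have "\<dots> \<longleftrightarrow> bs ! k"
      using k assms nth_eq_iff_index_eq[OF distinct_edge_list] unfolding ij[symmetric] by auto
    finally show ?thesis by (simp add: ij)
  qed
  then show "graph_code n (graph_of ?A) = bs"
    unfolding graph_code_def using assms by (intro nth_equalityI) auto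
qed

lemma card_bad_code_le:
  "finite {x. bad_code n x}"
  "card {x. bad_code n x} \<le> 2 ^ (n * (n - 1) div 2) * bad_bound n"
proof -
  let ?bad = "{A. A \<subseteq> set (edge_list n) \<and> bad n (graph_of A)}"
  have "x \<in> (\<lambda>A. nat_of_bits (graph_code n (graph_of A))) ` ?bad" if x: "bad_code n x" for x
  proof -
    let ?N = "n * (n - 1) div 2" and ?l = "length (bits_of_nat x)"
    \<comment> \<open>Comparing the two ranges for \<open>Suc x\<close> forces the decoded string to
      have exactly \<open>?N\<close> bits.\<close>
    have "(2::nat) ^ ?l < 2 ^ Suc ?N" "(2::nat) ^ ?N < 2 ^ Suc ?l"
      using x nat_of_bits_bounds[of "bits_of_nat x"]
      unfolding bad_code_def nat_of_bits_of_nat by linarith+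
    then have "?l < Suc ?N" "?N < Suc ?l" by (simp_all only: power_strict_increasing_iff one_less_numeral_iff semiring_norm)
    then have "?l = length (edge_list n)" by (simp add: length_edge_list)
    then obtain A where A: "A \<subseteq> set (edge_list n)" "graph_code n (graph_of A) = bits_of_nat x"
      by (rule graph_code_surj)
    then have "adj n x = graph_of A"
      using adj_graph_code[OF labeled_graph_graph_of[OF A(1)]] by (simp add: nat_of_bits_of_nat)
    then show ?thesis
      using A x by (intro image_eqI[of _ _ A]) (auto simp: nat_of_bits_of_nat bad_code_def)
  qed
  then have sub: "{x. bad_code n x} \<subseteq> (\<lambda>A. nat_of_bits (graph_code n (graph_of A))) ` ?bad" by blast
  have fin: "finite ?bad" by (rule finite_subset[of _ "Pow (set (edge_list n))"]) auto
  show "finite {x. bad_code n x}" using sub fin by (rule finite_subset[OF _ finite_imageI])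
  have "real (card {x. bad_code n x}) \<le> real (card ?bad)"
    using surj_card_le[OF fin sub] by simp
  also have "real (card ?bad) = 2 ^ (n * (n - 1) div 2) *
      avg (set (edge_list n)) (\<lambda>A. of_bool (bad n (graph_of A)))"
    by (simp add: avg_of_bool distinct_card[OF distinct_edge_list] length_edge_list)
  also have "\<dots> \<le> 2 ^ (n * (n - 1) div 2) * bad_bound n"
    by (intro mult_left_mono avg_bad_le) simp
  finally show "card {x. bad_code n x} \<le> 2 ^ (n * (n - 1) div 2) * bad_bound n" .
qed

text \<open>Randomness forces \<open>2 ^ KC\<close> to be at least \<open>2 ^ N / n powr c\<close>
  for \<open>N\<close> possible edges, while the index description bounds it by a constant times
  \<open>2 ^ N * bad_bound n\<close>. Exponential decay of \<open>bad_bound\<close> beats the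
  polynomial loss.\<close>

lemma random_graph_not_bad:
  assumes "universal U"
  shows "\<exists>N0. \<forall>n\<ge>N0. \<forall>G. random_graph U (c * log 2 (real n)) n G \<longrightarrow> \<not> bad n G"
proof -
  obtain C where C: "\<And>n x. bad_code n x \<Longrightarrow>
      2 ^ KC U (bits_of_nat x) (bits_of_nat n) \<le> 2 ^ C * card {y. bad_code n y}"
    using two_power_KC_le[OF assms, of bad_code] decidable_bad_code card_bad_code_le(1) by blast
  have "eventually (\<lambda>n. 2 ^ C * real n powr c * bad_bound n < 1)
      at_top"
    unfolding bad_bound_def by real_asymp
  then obtain N0 where N0: "\<And>n. n \<ge> N0 \<Longrightarrow>
      2 ^ C * real n powr c * bad_bound n < 1"
    unfolding eventually_at_top_linorder by blast
  \<comment> \<open>\<open>n\<close> is kept positive for the identity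
    \<open>2 powr (c * log 2 n) = n powr c\<close>.\<close>
  have "\<not> bad n G" if n: "n \<ge> max 1 N0" and G: "random_graph U (c * log 2 (real n)) n G" for n G
  proof
    assume "bad n G"
    let ?N = "n * (n - 1) div 2" and ?K = "KC U (graph_code n G) (bits_of_nat n)"
    let ?e = "bad_bound n"
    have "labeled_graph n G" and K: "real ?N - c * log 2 (real n) \<le> real ?K"
      using G by (auto simp: random_graph_def)
    then have "2 ^ ?K \<le> 2 ^ C * card {y. bad_code n y}"
      using C[OF bad_code_graph_code] \<open>bad n G\<close> by (simp add: bits_of_nat_of_bits)
    then have "real (2 ^ ?K) \<le> real (2 ^ C * card {y. bad_code n y})"
      by (simp only: of_nat_le_iff)
    then have "2 ^ ?K \<le> 2 ^ C * real (card {y. bad_code n y})"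
      by (simp only: of_nat_mult of_nat_power of_nat_numeral)
    also have "\<dots> \<le> 2 ^ C * (2 ^ ?N * ?e)"
      by (intro mult_left_mono card_bad_code_le) simp
    finally have "2 ^ ?K * real n powr c \<le> 2 ^ C * (2 ^ ?N * ?e) * real n powr c"
      by (rule mult_right_mono) simp
    also have "\<dots> = 2 ^ ?N * (2 ^ C * real n powr c * ?e)"
      by (simp only: mult_ac)
    also have "\<dots> < 2 ^ ?N * 1"
      using N0[of n] n by (intro mult_strict_left_mono) auto
    also have "2 ^ ?N * 1 = 2 powr (real ?N - c * log 2 (real n)) * real n powr c"
    proof -
      have "2 powr (c * log 2 (real n)) = real n powr c"
        using n by (simp add: mult.commute[of c] flip: powr_powr)
      then show ?thesis using n by (simp add: powr_diff powr_realpow)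
    qed
    also have "\<dots> \<le> 2 powr ?K * real n powr c"
      using K by (intro mult_right_mono powr_mono) auto
    finally show False by (simp add: powr_realpow)
  qed
  then show ?thesis by blast
qed

theorem theorem1:
  fixes U :: descr and c :: real
  assumes "universal U" and "c \<ge> 0"
  shows "(\<exists>D N0. \<forall>n \<ge> N0. \<forall>G. random_graph U (c * log 2 (real n)) n G \<longrightarrow>
            (\<exists>P mem. IB_scheme D n G P mem \<and> (\<forall>x \<in> {1..n}. length (mem x) \<le> 3 * n) \<and>
               (\<Sum>x\<in>{1..n}. length (mem x)) \<le> 3 * n ^ 2))
       \<and> (\<exists>D N0. \<forall>n \<ge> N0. \<forall>G. random_graph U (c * log 2 (real n)) n G \<longrightarrow>
            (\<exists>mem. II_scheme D n G mem \<and> (\<forall>x \<in> {1..n}. length (mem x) \<le> 3 * n) \<and>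
               (\<Sum>x\<in>{1..n}. length (mem x)) \<le> 3 * n ^ 2))"
proof -
  obtain N0 where N0: "\<And>n G. n \<ge> N0 \<Longrightarrow> random_graph U (c * log 2 (real n)) n G \<Longrightarrow>
      labeled_graph n G \<and> \<not> bad n G"
    using random_graph_not_bad[OF assms(1), of c] by (auto simp: random_graph_def)
  have space: "(\<forall>x\<in>{1..n}. length (table n G x) \<le> 3 * n) \<and>
      (\<Sum>x\<in>{1..n}. length (table n G x)) \<le> 3 * n ^ 2"
    if "n \<ge> N0" "random_graph U (c * log 2 (real n)) n G" for n G
  proof -
    have le: "length (table n G x) \<le> 3 * n" if "x \<in> {1..n}" for x
      using length_table_le N0 that \<open>n \<ge> N0\<close> \<open>random_graph U (c * log 2 (real n)) n G\<close> by metis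
    then have "(\<Sum>x\<in>{1..n}. length (table n G x)) \<le> (\<Sum>x\<in>{1..n}. 3 * n)" by (rule sum_mono)
    with le show ?thesis by (simp add: power2_eq_square)
  qed
  have "\<exists>P mem. IB_scheme IB_decoder n G P mem \<and> (\<forall>x \<in> {1..n}. length (mem x) \<le> 3 * n) \<and>
      (\<Sum>x\<in>{1..n}. length (mem x)) \<le> 3 * n ^ 2"
    if "n \<ge> N0" "random_graph U (c * log 2 (real n)) n G" for n G
    using N0[OF that] space[OF that] IB_scheme_table by blast
  moreover have "\<exists>mem. II_scheme II_decoder n G mem \<and> (\<forall>x \<in> {1..n}. length (mem x) \<le> 3 * n) \<and>
      (\<Sum>x\<in>{1..n}. length (mem x)) \<le> 3 * n ^ 2"
    if "n \<ge> N0" "random_graph U (c * log 2 (real n)) n G" for n G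
    using N0[OF that] space[OF that] II_scheme_table by blast
  ultimately show ?thesis by blast
qed

end
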